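(* Let $(M,g)$ be a transverse, type changing $C^k$-spacetime with $k\ge 2$, let $\mathcal D=\{y\in M : g_y \text{ is degenerate}\}$, and let $x\in\mathcal D$. If the radical $\mathrm{Rad}_x$ is not transverse to $T_x\mathcal D$ (that is, $\mathrm{Rad}_x\subset T_x\mathcal D$), then the energy momentum tensor $T_{ab}$ of $g$ is unbounded at $x$.
   Context: A *transverse, type changing $C^k$-spacetime* is a pair $(M,g)$ where $M$ is a smooth 4-dimensional manifold and $g$ is a symmetric $C^k$ $(0,2)$-tensor field on $M$ such that: - at every point $y$ of $\mathcal D=\{y\in M : g_y \text{ is degenerate}\}$ one has $d(\det(g_{ab}))|_y\neq0$ in some (hence any) coordinate system; - at every point where $g$ is non-degenerate it is either Riemannian or Lorentzian. The set $\mathcal D$ is then a hypersurface. The *radical* at $y\in\mathcal D$ is $\mathrm{Rad}_y=\{v\in T_yM : g(v,\cdot)=0\}$, which is one-dimensional. The energy momentum tensor is defined on $M\setminus\mathcal D$ through the Einstein equation, i.e. (up to a nonzero constant factor) $T=\mathrm{Ric}-\tfrac12 s\,g$, where $\mathrm{Ric}$ is the Ricci tensor and $s$ the scalar curvature of the non-degenerate metric $g|_{M\setminus\mathcal D}$. "$T_{ab}$ is unbounded at $x$" means that, with respect to coordinates (or a continuous frame) defined on a neighbourhood of $x$ in $M$, the components of $T$ are not all bounded on $U\setminus\mathcal D$ for any neighbourhood $U$ of $x$. *)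

theory Defs
  imports "HOL-Analysis.Analysis" "HOL-Library.Extended_Nat"
begin

section \<open>Differentiability classes\<close>

text \<open>Meant for open \<open>S\<close>. In finite dimensions, continuity of all iterated directional
  derivatives is the usual notion of \<open>C^n\<close>.\<close>

fun Cn_on :: "nat \<Rightarrow> ('a::real_normed_vector \<Rightarrow> 'b::real_normed_vector) \<Rightarrow> 'a set \<Rightarrow> bool" where
  "Cn_on 0 f S \<longleftrightarrow> continuous_on S f"
| "Cn_on (Suc n) f S \<longleftrightarrow> (\<forall>x\<in>S. f differentiable (at x)) \<and>
     (\<forall>v. Cn_on n (\<lambda>x. frechet_derivative f (at x) v) S)"

definition Ck_on :: "enat \<Rightarrow> ('a::real_normed_vector \<Rightarrow> 'b::real_normed_vector) \<Rightarrow> 'a set \<Rightarrow> bool" where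
  "Ck_on k f S \<longleftrightarrow> (\<forall>n. enat n \<le> k \<longrightarrow> Cn_on n f S)"

section \<open>Smooth 4-manifolds\<close>

text \<open>The manifold is a whole type. A chart is a pair of an open domain and a coordinate map,
  whose values outside the domain are irrelevant.\<close>

type_synonym 'm chart = "'m set \<times> ('m \<Rightarrow> real^4)"

abbreviation cdom :: "'m chart \<Rightarrow> 'm set" where "cdom \<equiv> fst"
abbreviation cmap :: "'m chart \<Rightarrow> 'm \<Rightarrow> real^4" where "cmap \<equiv> snd"
abbreviation cimage :: "'m chart \<Rightarrow> (real^4) set" where "cimage c \<equiv> cmap c ` cdom c"
abbreviation cinv :: "'m chart \<Rightarrow> real^4 \<Rightarrow> 'm" where "cinv c \<equiv> inv_into (cdom c) (cmap c)"

definition is_chart :: "'m::topological_space chart \<Rightarrow> bool" where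
  "is_chart c \<longleftrightarrow> open (cdom c) \<and> open (cimage c) \<and>
     homeomorphism (cdom c) (cimage c) (cmap c) (cinv c)"

definition transition :: "'m chart \<Rightarrow> 'm chart \<Rightarrow> real^4 \<Rightarrow> real^4" where
  "transition c c' = cmap c' \<circ> cinv c"

definition smoothly_compatible :: "'m chart \<Rightarrow> 'm chart \<Rightarrow> bool" where
  "smoothly_compatible c c' \<longleftrightarrow>
     Ck_on \<infinity> (transition c c') (cmap c ` (cdom c \<inter> cdom c')) \<and>
     Ck_on \<infinity> (transition c' c) (cmap c' ` (cdom c \<inter> cdom c'))"

text \<open>A smooth structure is a maximal smooth atlas.\<close>

definition smooth_structure :: "'m::{t2_space, second_countable_topology} chart set \<Rightarrow> bool" where
  "smooth_structure A \<longleftrightarrow>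
     (\<forall>c\<in>A. is_chart c) \<and> (\<Union>c\<in>A. cdom c) = UNIV \<and>
     (\<forall>c\<in>A. \<forall>c'\<in>A. smoothly_compatible c c') \<and>
     (\<forall>c. is_chart c \<and> (\<forall>c'\<in>A. smoothly_compatible c c') \<longrightarrow> c \<in> A)"

definition charts_at :: "'m chart set \<Rightarrow> 'm \<Rightarrow> 'm chart set" where
  "charts_at A y = {c\<in>A. y \<in> cdom c}"

section \<open>Tangent vectors and tensor fields\<close>

text \<open>A tangent vector at \<open>y\<close> assigns to every chart around \<open>y\<close> its coordinate vector, subject to
  the transformation law. It is set to 0 on all other charts, so that equality of tangent vectors
  is equality of functions; the vector space operations are pointwise.\<close>

type_synonym 'm tvec = "'m chart \<Rightarrow> real^4"

definition tangent_space :: "'m chart set \<Rightarrow> 'm \<Rightarrow> 'm tvec set" where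
  "tangent_space A y = {v.
     (\<forall>c\<in>charts_at A y. \<forall>c'\<in>charts_at A y.
        v c' = frechet_derivative (transition c c') (at (cmap c y)) (v c)) \<and>
     (\<forall>c. c \<notin> charts_at A y \<longrightarrow> v c = 0)}"

definition coord_vec :: "'m chart set \<Rightarrow> 'm chart \<Rightarrow> 'm \<Rightarrow> 4 \<Rightarrow> 'm tvec" where
  "coord_vec A c y i = (\<lambda>c'. if c' \<in> charts_at A y
     then frechet_derivative (transition c c') (at (cmap c y)) (axis i 1) else 0)"

text \<open>Only the values of \<open>g y\<close> on the tangent space at \<open>y\<close> matter. Bilinearity in the second
  argument follows from symmetry.\<close>

definition symmetric_bilinear_field ::
  "'m chart set \<Rightarrow> ('m \<Rightarrow> 'm tvec \<Rightarrow> 'm tvec \<Rightarrow> real) \<Rightarrow> bool" where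
  "symmetric_bilinear_field A g \<longleftrightarrow>
     (\<forall>y. \<forall>u\<in>tangent_space A y. \<forall>v\<in>tangent_space A y. g y u v = g y v u) \<and>
     (\<forall>y. \<forall>u\<in>tangent_space A y. \<forall>v\<in>tangent_space A y. \<forall>w\<in>tangent_space A y. \<forall>a b.
        g y (\<lambda>c. a *\<^sub>R u c + b *\<^sub>R v c) w = a * g y u w + b * g y v w)"

definition metric_components ::
  "'m chart set \<Rightarrow> ('m \<Rightarrow> 'm tvec \<Rightarrow> 'm tvec \<Rightarrow> real) \<Rightarrow> 'm chart \<Rightarrow> real^4 \<Rightarrow> real^4^4" where
  "metric_components A g c z =
     (\<chi> i j. g (cinv c z) (coord_vec A c (cinv c z) i) (coord_vec A c (cinv c z) j))"

definition Ck_symmetric_tensor_field ::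
  "enat \<Rightarrow> 'm chart set \<Rightarrow> ('m \<Rightarrow> 'm tvec \<Rightarrow> 'm tvec \<Rightarrow> real) \<Rightarrow> bool" where
  "Ck_symmetric_tensor_field k A g \<longleftrightarrow> symmetric_bilinear_field A g \<and>
     (\<forall>c\<in>A. \<forall>i j. Ck_on k (\<lambda>z. metric_components A g c z $ i $ j) (cimage c))"

section \<open>Transverse, type changing spacetimes\<close>

definition metric_radical ::
  "'m chart set \<Rightarrow> ('m \<Rightarrow> 'm tvec \<Rightarrow> 'm tvec \<Rightarrow> real) \<Rightarrow> 'm \<Rightarrow> 'm tvec set" where
  "metric_radical A g y = {v\<in>tangent_space A y. \<forall>w\<in>tangent_space A y. g y v w = 0}"

definition degenerate_set ::
  "'m chart set \<Rightarrow> ('m \<Rightarrow> 'm tvec \<Rightarrow> 'm tvec \<Rightarrow> real) \<Rightarrow> 'm set" where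
  "degenerate_set A g = {y. metric_radical A g y \<noteq> {\<lambda>_. 0}}"

definition riemannian_at ::
  "'m chart set \<Rightarrow> ('m \<Rightarrow> 'm tvec \<Rightarrow> 'm tvec \<Rightarrow> real) \<Rightarrow> 'm \<Rightarrow> bool" where
  "riemannian_at A g y \<longleftrightarrow> (\<forall>v\<in>tangent_space A y. v \<noteq> (\<lambda>_. 0) \<longrightarrow> g y v v > 0)"

text \<open>Signature \<open>(-,+,+,+)\<close>, expressed by an orthonormal basis (four orthonormal vectors in a
  4-dimensional space are automatically a basis).\<close>

definition lorentzian_at ::
  "'m chart set \<Rightarrow> ('m \<Rightarrow> 'm tvec \<Rightarrow> 'm tvec \<Rightarrow> real) \<Rightarrow> 'm \<Rightarrow> bool" where
  "lorentzian_at A g y \<longleftrightarrow> (\<exists>e :: 4 \<Rightarrow> 'm tvec. (\<forall>i. e i \<in> tangent_space A y) \<and>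
     (\<forall>i j. g y (e i) (e j) = (if i \<noteq> j then 0 else if i = 0 then -1 else 1)))"

definition transverse_type_changing_spacetime ::
  "enat \<Rightarrow> 'm::{t2_space, second_countable_topology} chart set
     \<Rightarrow> ('m \<Rightarrow> 'm tvec \<Rightarrow> 'm tvec \<Rightarrow> real) \<Rightarrow> bool" where
  "transverse_type_changing_spacetime k A g \<longleftrightarrow>
     smooth_structure A \<and> Ck_symmetric_tensor_field k A g \<and>
     (\<forall>y\<in>degenerate_set A g. \<exists>c\<in>charts_at A y.
        frechet_derivative (\<lambda>z. det (metric_components A g c z)) (at (cmap c y)) \<noteq> (\<lambda>_. 0)) \<and>
     (\<forall>y. y \<notin> degenerate_set A g \<longrightarrow> riemannian_at A g y \<or> lorentzian_at A g y)"

text \<open>Tangent space at \<open>y\<close> of a hypersurface \<open>D\<close>: velocities at time 0 of \<open>C^1\<close> curves in \<open>D\<close>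
  through \<open>y\<close>. After shrinking \<open>\<epsilon>\<close>, a curve runs inside the domain of a single chart.\<close>

definition hypersurface_tangent_space :: "'m chart set \<Rightarrow> 'm set \<Rightarrow> 'm \<Rightarrow> 'm tvec set" where
  "hypersurface_tangent_space A D y = {v\<in>tangent_space A y.
     \<exists>c\<in>charts_at A y. \<exists>\<gamma> \<epsilon>. \<epsilon> > 0 \<and> \<gamma> 0 = y \<and> \<gamma> ` {-\<epsilon><..<\<epsilon>} \<subseteq> D \<inter> cdom c \<and>
       Ck_on 1 (cmap c \<circ> \<gamma>) {-\<epsilon><..<\<epsilon>} \<and>
       ((cmap c \<circ> \<gamma>) has_vector_derivative v c) (at (0::real))}"

section \<open>Curvature in coordinates\<close>

text \<open>Here \<open>G\<close> is the matrix of a metric as a function of the coordinates. These quantities are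
  meaningful only where \<open>G\<close> is invertible.\<close>

definition partial_deriv :: "4 \<Rightarrow> (real^4 \<Rightarrow> real) \<Rightarrow> real^4 \<Rightarrow> real" where
  "partial_deriv i f z = frechet_derivative f (at z) (axis i 1)"

definition christoffel :: "(real^4 \<Rightarrow> real^4^4) \<Rightarrow> 4 \<Rightarrow> 4 \<Rightarrow> 4 \<Rightarrow> real^4 \<Rightarrow> real" where
  "christoffel G a b c z = (1/2) * (\<Sum>d\<in>UNIV. matrix_inv (G z) $ a $ d *
     (partial_deriv b (\<lambda>w. G w $ d $ c) z + partial_deriv c (\<lambda>w. G w $ d $ b) z
      - partial_deriv d (\<lambda>w. G w $ b $ c) z))"

text \<open>\<open>riemann G a b c d\<close> is the component \<open>R^a_bcd\<close>, with \<open>R(X,Y)Z = [\<nabla>_X,\<nabla>_Y]Z - \<nabla>_[X,Y] Z\<close> and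
  \<open>R(\<partial>_c,\<partial>_d)\<partial>_b = R^a_bcd \<partial>_a\<close>.\<close>

definition riemann :: "(real^4 \<Rightarrow> real^4^4) \<Rightarrow> 4 \<Rightarrow> 4 \<Rightarrow> 4 \<Rightarrow> 4 \<Rightarrow> real^4 \<Rightarrow> real" where
  "riemann G a b c d z =
     partial_deriv c (christoffel G a d b) z - partial_deriv d (christoffel G a c b) z
     + (\<Sum>e\<in>UNIV. christoffel G a c e z * christoffel G e d b z
                 - christoffel G a d e z * christoffel G e c b z)"

definition ricci :: "(real^4 \<Rightarrow> real^4^4) \<Rightarrow> 4 \<Rightarrow> 4 \<Rightarrow> real^4 \<Rightarrow> real" where
  "ricci G b d z = (\<Sum>a\<in>UNIV. riemann G a b a d z)"

definition scalar_curvature :: "(real^4 \<Rightarrow> real^4^4) \<Rightarrow> real^4 \<Rightarrow> real" where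
  "scalar_curvature G z = (\<Sum>a\<in>UNIV. \<Sum>b\<in>UNIV. matrix_inv (G z) $ a $ b * ricci G a b z)"

definition energy_momentum :: "(real^4 \<Rightarrow> real^4^4) \<Rightarrow> 4 \<Rightarrow> 4 \<Rightarrow> real^4 \<Rightarrow> real" where
  "energy_momentum G a b z = ricci G a b z - (1/2) * scalar_curvature G z * G z $ a $ b"

text \<open>Unboundedness is required in every chart around \<open>x\<close>.\<close>

definition energy_momentum_unbounded_at ::
  "'m::topological_space chart set \<Rightarrow> ('m \<Rightarrow> 'm tvec \<Rightarrow> 'm tvec \<Rightarrow> real) \<Rightarrow> 'm \<Rightarrow> bool" where
  "energy_momentum_unbounded_at A g x \<longleftrightarrow>
     (\<forall>c\<in>charts_at A x. \<forall>U. open U \<and> x \<in> U \<and> U \<subseteq> cdom c \<longrightarrow>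
        \<not> (\<exists>B. \<forall>y\<in>U - degenerate_set A g. \<forall>a b.
              \<bar>energy_momentum (metric_components A g c) a b (cmap c y)\<bar> \<le> B))"

end

theory Submission
  imports Defs
begin

text \<open>Write \<open>\<delta> = det (g_ab)\<close> in a chart around \<open>x\<close>. The Christoffel symbols are \<open>C^1\<close> functions divided by \<open>\<delta>\<close>,
  so \<open>\<delta>^2 Ric\<close> extends continuously across the degenerate set. At a degenerate point the cofactor
  matrix of \<open>g\<close> is a multiple of \<open>v \<otimes> v\<close> with \<open>v\<close> spanning the radical, and if \<open>d\<delta>(v) = 0\<close>, then the
  extension takes the value \<open>(1/4) d\<delta> \<otimes> d\<delta> \<noteq> 0\<close>. On the other hand the trace of \<open>T\<close> is \<open>-s\<close>; hence if \<open>T\<close>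
  is bounded, so is \<open>\<delta> s\<close>, and \<open>\<delta>^2 Ric = \<delta>^2 T + (1/2) \<delta> (\<delta> s) g\<close> tends to 0 at \<open>x\<close>.\<close>

section \<open>Functions of class \<open>C^n\<close>\<close>

text \<open>The recursion demands differentiability at lower orders and continuity only at the last;
  the base case recovers continuity from differentiability.\<close>

lemma Cn_on_SucD: "Cn_on (Suc n) f S \<Longrightarrow> Cn_on n f S"
proof (induction n arbitrary: f)
  case 0
  then show ?case
    by (auto intro!: continuous_at_imp_continuous_on differentiable_imp_continuous_within)
next
  case (Suc n)
  then show ?case by (metis Cn_on.simps(2))
qed

text \<open>The derivative is a choice over a predicate that \<open>f\<close> and \<open>h\<close>
  satisfy for the same candidates at \<open>x\<close>, so the two values agree even where neither
  function is differentiable.\<close>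

lemma frechet_derivative_cong_open:
  assumes "open S" "x \<in> S" "\<And>x. x \<in> S \<Longrightarrow> f x = h x"
  shows "frechet_derivative f (at x) = frechet_derivative h (at x)"
proof -
  have "(f has_derivative f') (at x) \<longleftrightarrow> (h has_derivative f') (at x)" for f'
    using has_derivative_transform_within_open[of f f' x UNIV S h]
      has_derivative_transform_within_open[of h f' x UNIV S f] assms by auto
  then show ?thesis
    by (simp add: frechet_derivative_def)
qed

lemma Cn_on_cong:
  assumes "open S" "\<And>x. x \<in> S \<Longrightarrow> f x = h x" "Cn_on n f S"
  shows "Cn_on n h S"
  using assms(2,3)
proof (induction n arbitrary: f h)
  case 0
  then show ?case by (auto cong: continuous_on_cong)
next
  case (Suc n)
  have "h differentiable (at x)" if "x \<in> S" for x
    using Suc.prems that assms(1) unfolding Cn_on.simps differentiable_def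
    by (metis has_derivative_transform_within_open)
  moreover have "Cn_on n (\<lambda>x. frechet_derivative h (at x) v) S" for v
  proof (rule Suc.IH)
    show "Cn_on n (\<lambda>x. frechet_derivative f (at x) v) S" using Suc.prems by simp
    show "frechet_derivative f (at x) v = frechet_derivative h (at x) v" if "x \<in> S" for x
      using frechet_derivative_cong_open[OF assms(1) that Suc.prems(1)] by simp
  qed
  ultimately show ?case by simp
qed

lemma Cn_on_const: "Cn_on n (\<lambda>x. c) S"
  by (induction n arbitrary: c) auto

lemma Cn_on_add:
  assumes "open S" "Cn_on n f S" "Cn_on n h S"
  shows "Cn_on n (\<lambda>x. f x + h x) S"
  using assms(2,3)
proof (induction n arbitrary: f h)
  case 0
  then show ?case by (auto intro: continuous_intros)
next
  case (Suc n)
  have "frechet_derivative (\<lambda>x. f x + h x) (at x)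
      = (\<lambda>v. frechet_derivative f (at x) v + frechet_derivative h (at x) v)" if "x \<in> S" for x
    using Suc.prems that frechet_derivative_works
    by (intro frechet_derivative_at[symmetric] has_derivative_add) auto
  moreover have "Cn_on n (\<lambda>x. frechet_derivative f (at x) v + frechet_derivative h (at x) v) S" for v
    using Suc by auto
  ultimately have "Cn_on n (\<lambda>x. frechet_derivative (\<lambda>x. f x + h x) (at x) v) S" for v
    by (intro Cn_on_cong[OF assms(1) _ \<open>Cn_on n (\<lambda>x. frechet_derivative f (at x) v + frechet_derivative h (at x) v) S\<close>]) simp_all
  with Suc.prems show ?case by auto
qed

lemma Cn_on_mult:
  fixes f h :: "'a::real_normed_vector \<Rightarrow> real"
  assumes "open S" "Cn_on n f S" "Cn_on n h S"
  shows "Cn_on n (\<lambda>x. f x * h x) S"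
  using assms(2,3)
proof (induction n arbitrary: f h)
  case 0
  then show ?case by (auto intro: continuous_intros)
next
  case (Suc n)
  have eq: "frechet_derivative (\<lambda>x. f x * h x) (at x)
      = (\<lambda>v. f x * frechet_derivative h (at x) v + frechet_derivative f (at x) v * h x)"
    if "x \<in> S" for x
    using Suc.prems that frechet_derivative_works
    by (intro frechet_derivative_at[symmetric] has_derivative_mult) auto
  \<comment> \<open>The Leibniz rule keeps one factor undifferentiated; \<open>Cn_on_SucD\<close>
    lowers it to order \<open>n\<close> so that the induction hypothesis applies to both
    products.\<close>
  have "Cn_on n (\<lambda>x. f x * frechet_derivative h (at x) v + frechet_derivative f (at x) v * h x) S" for v
    using Suc.prems Suc.prems[THEN Cn_on_SucD] by (intro Cn_on_add[OF assms(1)] Suc.IH) auto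
  then have "Cn_on n (\<lambda>x. frechet_derivative (\<lambda>x. f x * h x) (at x) v) S" for v
    by (rule Cn_on_cong[OF assms(1), rotated]) (simp add: eq)
  with Suc.prems show ?case
    unfolding Cn_on.simps by (blast intro: differentiable_mult)
qed

lemma Cn_on_sum:
  assumes "open S" "\<And>i. i \<in> I \<Longrightarrow> Cn_on n (f i) S"
  shows "Cn_on n (\<lambda>x. \<Sum>i\<in>I. f i x) S"
  using assms(2)
  by (induction I rule: infinite_finite_induct) (auto intro: Cn_on_const Cn_on_add[OF assms(1)])

lemma Cn_on_prod:
  fixes f :: "'i \<Rightarrow> 'a::real_normed_vector \<Rightarrow> real"
  assumes "open S" "\<And>i. i \<in> I \<Longrightarrow> Cn_on n (f i) S"
  shows "Cn_on n (\<lambda>x. \<Prod>i\<in>I. f i x) S"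
  using assms(2)
  by (induction I rule: infinite_finite_induct) (auto intro: Cn_on_const Cn_on_mult[OF assms(1)])

lemma Cn_on_det:
  fixes M :: "'a::real_normed_vector \<Rightarrow> real^'n^'n"
  assumes "open S" "\<And>i j. Cn_on n (\<lambda>x. M x $ i $ j) S"
  shows "Cn_on n (\<lambda>x. det (M x)) S"
  unfolding det_def
  by (intro Cn_on_sum[OF assms(1)] Cn_on_mult[OF assms(1)] Cn_on_prod[OF assms(1)] Cn_on_const assms(2))

section \<open>Cofactors\<close>

text \<open>Putting a unit vector into row \<open>i\<close>, instead of deleting a row and a column,
  reduces Laplace expansion to linearity in that row. The transpose is the adjugate; it is
  polynomial in the entries and makes sense for singular matrices.\<close>

definition cofactors :: "real^'n^'n \<Rightarrow> real^'n^'n" where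
  "cofactors M = (\<chi> i j. det (\<chi> k. if k = i then axis j 1 else M $ k))"

lemma Cn_on_cofactors:
  fixes M :: "'a::real_normed_vector \<Rightarrow> real^'n^'n"
  assumes "open S" "\<And>i j. Cn_on n (\<lambda>x. M x $ i $ j) S"
  shows "Cn_on n (\<lambda>x. cofactors (M x) $ i $ j) S"
proof -
  have "Cn_on n (\<lambda>x. (\<chi> k. if k = i then axis j 1 else M x $ k) $ k $ l) S" for k l
    by (cases "k = i") (auto intro: Cn_on_const assms(2))
  from Cn_on_det[OF assms(1) this] show ?thesis
    by (simp add: cofactors_def)
qed

text \<open>Laplace expansion along row \<open>i\<close>: write \<open>w\<close> in the standard
  basis and use linearity of the determinant in one row.\<close>

lemma det_replace_row:
  "det (\<chi> k. if k = i then w else M $ k) = (\<Sum>j\<in>UNIV. w $ j * cofactors M $ i $ j)"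
proof -
  have "det (\<chi> k. if k = i then w else M $ k)
      = det (\<chi> k. if k = i then (\<Sum>j\<in>UNIV. w $ j *s axis j 1) else M $ k)"
    by (simp only: basis_expansion)
  also have "\<dots> = (\<Sum>j\<in>UNIV. det (\<chi> k. if k = i then w $ j *s axis j 1 else M $ k))"
    by (rule det_linear_row_sum) simp
  also have "\<dots> = (\<Sum>j\<in>UNIV. w $ j * cofactors M $ i $ j)"
    by (simp add: det_row_mul cofactors_def)
  finally show ?thesis .
qed

text \<open>Replacing row \<open>i\<close> by row \<open>k\<close> restores \<open>M\<close> if
  \<open>k = i\<close> and creates two equal rows otherwise.\<close>

lemma cofactors_expansion:
  "(\<Sum>j\<in>UNIV. M $ k $ j * cofactors M $ i $ j) = (if k = i then det M else 0)"
proof -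
  have "(\<Sum>j\<in>UNIV. M $ k $ j * cofactors M $ i $ j) = det (\<chi> l. if l = i then M $ k else M $ l)"
    by (simp add: det_replace_row)
  also have "\<dots> = (if k = i then det M else 0)"
  proof (cases "k = i")
    case True
    then have "(\<chi> l. if l = i then M $ k else M $ l) = M" by (simp add: vec_eq_iff)
    with True show ?thesis by simp
  next
    case False
    then show ?thesis
      by (auto intro!: det_identical_rows[of i k] simp: row_def)
  qed
  finally show ?thesis .
qed

text \<open>A right inverse of a square matrix is two-sided, so the choice in
  \<open>matrix_inv\<close> yields a genuine inverse, and inverses are unique.\<close>

lemma matrix_inv_eqI:
  fixes M N :: "real^'n^'n"
  assumes "M ** N = mat 1"
  shows "matrix_inv M = N"
proof -
  have "\<exists>N. M ** N = mat 1 \<and> N ** M = mat 1"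
    using assms matrix_left_right_inverse by blast
  then have "matrix_inv M ** M = mat 1"
    unfolding matrix_inv_def by (rule someI2_ex) blast
  then show ?thesis
    by (metis assms matrix_mul_assoc matrix_mul_lid matrix_mul_rid)
qed

lemma matrix_inv_cofactors:
  assumes "det M \<noteq> 0"
  shows "matrix_inv M $ a $ d = cofactors M $ d $ a / det M"
proof -
  have "M ** (\<chi> a d. cofactors M $ d $ a / det M) = mat 1"
    using assms cofactors_expansion[of M]
    by (simp add: matrix_matrix_mult_def mat_def vec_eq_iff sum_divide_distrib[symmetric])
  then show ?thesis by (simp add: matrix_inv_eqI)
qed

text \<open>The inverse of a symmetric matrix is symmetric, and up to the factor
  \<open>det M\<close> its entries are the cofactors. Singular matrices are reached later by a
  limit.\<close>

lemma cofactors_sym: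
  assumes "transpose M = M" "det M \<noteq> 0"
  shows "cofactors M $ a $ d = cofactors M $ d $ a"
proof -
  obtain N where N: "M ** N = mat 1" "N ** M = mat 1"
    using assms(2) by (auto simp: invertible_det_nz[symmetric] invertible_def)
  have "M ** transpose N = mat 1"
    using N(2) assms(1) by (metis matrix_transpose_mul transpose_mat)
  from matrix_inv_eqI[OF this] matrix_inv_eqI[OF N(1)]
  have "transpose N = N" and inv: "matrix_inv M = N" by auto
  then have "transpose N $ a $ d = N $ a $ d" by simp
  then have "N $ d $ a = N $ a $ d"
    by (simp add: Finite_Cartesian_Product.transpose_def)
  then show ?thesis
    using matrix_inv_cofactors[OF assms(2), of a d] matrix_inv_cofactors[OF assms(2), of d a] assms(2)
    by (simp add: inv)
qed

text \<open>Jacobi's formula. In the permutation expansion, the terms whose factor from row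
  \<open>i\<close> is differentiated add up to the determinant with row \<open>i\<close> replaced by
  its derivative, which \<open>det_replace_row\<close> expands.\<close>

lemma has_derivative_det:
  fixes M :: "'a::real_normed_vector \<Rightarrow> real^'n^'n"
  assumes "\<And>i j. ((\<lambda>x. M x $ i $ j) has_derivative (\<lambda>h. M' h i j)) (at x)"
  shows "((\<lambda>x. det (M x)) has_derivative
    (\<lambda>h. \<Sum>i\<in>UNIV. \<Sum>j\<in>UNIV. M' h i j * cofactors (M x) $ i $ j)) (at x)"
proof -
  let ?P = "{p. p permutes (UNIV :: 'n set)}"
  have "((\<lambda>x. det (M x)) has_derivative
      (\<lambda>h. \<Sum>p\<in>?P. of_int (sign p) * (\<Sum>i\<in>UNIV. M' h i (p i) * (\<Prod>j\<in>UNIV - {i}. M x $ j $ p j)))) (at x)"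
    unfolding det_def
    by (intro has_derivative_sum has_derivative_mult_right has_derivative_prod assms)
  moreover have "(\<Sum>p\<in>?P. of_int (sign p) * (\<Sum>i\<in>UNIV. M' h i (p i) * (\<Prod>j\<in>UNIV - {i}. M x $ j $ p j)))
      = (\<Sum>i\<in>UNIV. \<Sum>j\<in>UNIV. M' h i j * cofactors (M x) $ i $ j)" for h
  proof -
    have "(\<Sum>j\<in>UNIV. M' h i j * cofactors (M x) $ i $ j)
        = (\<Sum>p\<in>?P. of_int (sign p) * (M' h i (p i) * (\<Prod>j\<in>UNIV - {i}. M x $ j $ p j)))" for i
    proof -
      have "(\<Sum>j\<in>UNIV. M' h i j * cofactors (M x) $ i $ j)
          = det (\<chi> k. if k = i then (\<chi> j. M' h i j) else M x $ k)"
        by (simp add: det_replace_row)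
      also have "\<dots> = (\<Sum>p\<in>?P. of_int (sign p) *
          (M' h i (p i) * (\<Prod>j\<in>UNIV - {i}. M x $ j $ p j)))"
        unfolding det_def
      proof (intro sum.cong refl)
        fix p assume "p \<in> ?P"
        have "(\<Prod>k\<in>UNIV. (\<chi> k. if k = i then \<chi> j. M' h i j else M x $ k) $ k $ p k)
          = M' h i (p i) * (\<Prod>k\<in>UNIV - {i}. M x $ k $ p k)"
          by (subst prod.remove[of _ i]) (auto intro!: prod.cong)
        then show "of_int (sign p) * (\<Prod>k\<in>UNIV. (\<chi> k. if k = i then \<chi> j. M' h i j else M x $ k) $ k $ p k)
          = of_int (sign p) * (M' h i (p i) * (\<Prod>j\<in>UNIV - {i}. M x $ j $ p j))"
          by simp
      qed
      finally show ?thesis .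
    qed
    then show ?thesis
      by (simp add: sum_distrib_left) (rule sum.swap)
  qed
  ultimately show ?thesis by simp
qed

text \<open>A nonzero cofactor says that replacing a single row of the singular matrix \<open>M\<close> makes it
  invertible, so a kernel vector is determined by one of its coordinates.\<close>

lemma cofactors_rank_one:
  assumes sym: "\<And>a d. cofactors M $ a $ d = cofactors M $ d $ a"
    and tr: "transpose M = M"
    and "det M = 0" "M *v v = 0" "v \<noteq> 0"
  obtains \<kappa> where "\<And>a d. cofactors M $ a $ d = \<kappa> * v $ a * v $ d"
proof (cases "cofactors M = 0")
  case True
  then show ?thesis using that[of 0] by simp
next
  case False
  then obtain a d where ad: "cofactors M $ a $ d \<noteq> 0"
    by (auto simp: vec_eq_iff)
  define N where "N = (\<chi> k. if k = a then axis d 1 else M $ k)"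
  have "det N \<noteq> 0"
    using ad by (simp add: cofactors_def N_def)
  have inj: "w = 0" if "M *v w = 0" "w $ d = 0" for w
  proof -
    have "M $ k \<bullet> w = 0" for k
      using that(1) by (metis matrix_vector_mul_component zero_index)
    then have "(N *v w) $ k = 0" for k
      using that by (cases "k = a")
        (simp_all add: N_def matrix_vector_mul_component inner_axis')
    then have "N *v w = 0" by (simp add: vec_eq_iff)
    then show "w = 0"
      using \<open>det N \<noteq> 0\<close> by (metis invertible_det_nz matrix_left_invertible_ker invertible_left_inverse)
  qed
  have vd: "v $ d \<noteq> 0" using inj assms by blast
  \<comment> \<open>Since \<open>det M = 0\<close>, row \<open>i\<close> of the cofactors lies in
    the kernel of \<open>M\<close>, as does \<open>v\<close>. Subtracting the multiple of
    \<open>v\<close> with the same coordinate \<open>d\<close> leaves a kernel vector that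
    \<open>inj\<close> forces to be 0.\<close>
  have row: "cofactors M $ i $ j = cofactors M $ i $ d / v $ d * v $ j" for i j
  proof -
    let ?w = "cofactors M $ i - (cofactors M $ i $ d / v $ d) *s v"
    have "M *v (cofactors M $ i) = 0"
      using cofactors_expansion[of M _ i] assms(3)
      by (simp add: matrix_vector_mult_def vec_eq_iff)
    then have "M *v ?w = 0"
      using assms(4) by (simp add: matrix_vector_mult_diff_distrib vector_scalar_commute)
    moreover have "?w $ d = 0" using vd by simp
    ultimately have "?w = 0" using inj by blast
    then have "?w $ j = 0" by simp
    then show ?thesis by simp
  qed
  \<comment> \<open>Symmetry turns the entry at \<open>i\<close>, \<open>d\<close> into the one at
    \<open>d\<close>, \<open>i\<close>, to which \<open>row\<close> applies a second time.\<close>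
  have "cofactors M $ i $ j = (cofactors M $ d $ d / (v $ d)\<^sup>2) * v $ i * v $ j" for i j
    using row[of i j] row[of d i] sym[of i d] vd by (simp add: power2_eq_square)
  then show ?thesis using that by blast
qed

section \<open>The Ricci tensor near a degenerate point\<close>

lemma linear_axis_expansion:
  fixes f :: "real^'n \<Rightarrow> 'b::real_vector"
  assumes "linear f"
  shows "f h = (\<Sum>i\<in>UNIV. h $ i *\<^sub>R f (axis i 1))"
proof -
  have "f h = f (\<Sum>i\<in>UNIV. h $ i *s axis i 1)"
    by (simp only: basis_expansion)
  then show ?thesis
    using assms by (simp add: linear_sum linear_scale scalar_mult_eq_scaleR)
qed

lemma frechet_derivative_partial:
  fixes f :: "real^4 \<Rightarrow> real"
  assumes "f differentiable (at z)"
  shows "frechet_derivative f (at z) h = (\<Sum>i\<in>UNIV. h $ i * partial_deriv i f z)"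
  using linear_axis_expansion[OF linear_frechet_derivative[OF assms], of h]
  by (simp add: partial_deriv_def)

lemma Cn_on_partial_deriv: "Cn_on (Suc n) f S \<Longrightarrow> Cn_on n (partial_deriv i f) S"
  by (simp add: partial_deriv_def[abs_def])

lemma partial_deriv_divide:
  assumes "f differentiable (at z)" "h differentiable (at z)" "h z \<noteq> 0"
  shows "partial_deriv i (\<lambda>w. f w / h w) z
    = (partial_deriv i f z * h z - f z * partial_deriv i h z) / (h z)\<^sup>2"
proof -
  have "((\<lambda>w. f w / h w) has_derivative (\<lambda>v. (frechet_derivative f (at z) v * h z
      - f z * frechet_derivative h (at z) v) / (h z * h z))) (at z)"
    using assms frechet_derivative_works by (intro has_derivative_divide') auto
  then show ?thesis
    unfolding partial_deriv_def
    by (simp add: frechet_derivative_at[symmetric] power2_eq_square)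
qed

text \<open>Serves to carry inequalities from nondegenerate points to a degenerate limit
  point.\<close>

lemma continuous_on_islimpt_nonneg:
  fixes f :: "'a::topological_space \<Rightarrow> real"
  assumes "continuous_on S f" "x \<in> S" "W \<subseteq> S" "x islimpt W" "\<And>z. z \<in> W \<Longrightarrow> 0 \<le> f z"
  shows "0 \<le> f x"
proof (rule tendsto_lowerbound)
  have "(f \<longlongrightarrow> f x) (at x within S)"
    using assms(1,2) by (simp add: continuous_on_def)
  then show "(f \<longlongrightarrow> f x) (at x within W)"
    using assms(3) by (rule tendsto_within_subset)
  show "\<forall>\<^sub>F z in at x within W. 0 \<le> f z"
    unfolding eventually_at_topological using assms(5) by blast
  show "at x within W \<noteq> bot"
    using assms(4) trivial_limit_within by blast
qed

section \<open>Curvature with the powers of the determinant cleared\<close>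

locale local_metric =
  fixes G :: "real^4 \<Rightarrow> real^4^4" and S :: "(real^4) set"
  assumes open_S: "open S"
    and transpose_G: "z \<in> S \<Longrightarrow> transpose (G z) = G z"
    and C2_G: "Cn_on 2 (\<lambda>z. G z $ i $ j) S"
begin

definition delta :: "real^4 \<Rightarrow> real" where "delta z = det (G z)"

text \<open>Christoffel symbols of the first kind: free of the inverse metric, hence regular at
  degenerate points.\<close>

definition lowered_christoffel :: "4 \<Rightarrow> 4 \<Rightarrow> 4 \<Rightarrow> real^4 \<Rightarrow> real" where
  "lowered_christoffel d b c z = (1/2) *
     (partial_deriv b (\<lambda>w. G w $ d $ c) z + partial_deriv c (\<lambda>w. G w $ d $ b) z
      - partial_deriv d (\<lambda>w. G w $ b $ c) z)"

text \<open>The Christoffel symbols of the second kind times \<open>delta\<close>, with the adjugate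
  in place of the inverse metric.\<close>

definition cleared_christoffel :: "4 \<Rightarrow> 4 \<Rightarrow> 4 \<Rightarrow> real^4 \<Rightarrow> real" where
  "cleared_christoffel a b c z =
     (\<Sum>d\<in>UNIV. cofactors (G z) $ d $ a * lowered_christoffel d b c z)"

text \<open>What results from the Ricci tensor by writing each Christoffel symbol as
  \<open>cleared_christoffel\<close> over \<open>delta\<close>, applying the quotient rule and
  multiplying by the square of \<open>delta\<close>.\<close>

definition cleared_ricci :: "4 \<Rightarrow> 4 \<Rightarrow> real^4 \<Rightarrow> real" where
  "cleared_ricci b d z = (\<Sum>a\<in>UNIV.
     (partial_deriv a (cleared_christoffel a d b) z * delta z
       - cleared_christoffel a d b z * partial_deriv a delta z)
     - (partial_deriv d (cleared_christoffel a a b) z * delta z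
       - cleared_christoffel a a b z * partial_deriv d delta z)
     + (\<Sum>e\<in>UNIV. cleared_christoffel a a e z * cleared_christoffel e d b z
         - cleared_christoffel a d e z * cleared_christoffel e a b z))"

lemma sym_G: "z \<in> S \<Longrightarrow> G z $ i $ j = G z $ j $ i"
  using arg_cong[OF transpose_G, of z "\<lambda>M. M $ i $ j"]
  by (simp add: Finite_Cartesian_Product.transpose_def)

lemma C1_G: "Cn_on 1 (\<lambda>z. G z $ i $ j) S"
  by (rule Cn_on_SucD) (use C2_G in \<open>simp only: numeral_2_eq_2 One_nat_def\<close>)

lemma C1_delta: "Cn_on 1 delta S"
  using Cn_on_det[OF open_S C1_G] unfolding delta_def[abs_def] .

lemma C1_cleared_christoffel: "Cn_on 1 (cleared_christoffel a b c) S"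
proof -
  have "Cn_on 1 (partial_deriv b (\<lambda>w. G w $ d $ c)) S" for b c d
    by (rule Cn_on_partial_deriv) (use C2_G in \<open>simp only: numeral_2_eq_2 One_nat_def\<close>)
  \<comment> \<open>The difference is written as a sum with a factor \<open>- 1\<close> to fit
    closure under sums and products.\<close>
  then have "Cn_on 1 (\<lambda>z. (1/2) * (partial_deriv b (\<lambda>w. G w $ d $ c) z
      + partial_deriv c (\<lambda>w. G w $ d $ b) z + (- 1) * partial_deriv d (\<lambda>w. G w $ b $ c) z)) S" for d
    by (intro Cn_on_mult[OF open_S] Cn_on_add[OF open_S] Cn_on_const)
  then have "Cn_on 1 (lowered_christoffel d b c) S" for d
    by (simp only: lowered_christoffel_def[abs_def] mult_minus1 add_uminus_conv_diff)
  then show ?thesis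
    unfolding cleared_christoffel_def[abs_def]
    by (intro Cn_on_sum[OF open_S] Cn_on_mult[OF open_S] Cn_on_cofactors[OF open_S] C1_G)
qed

lemma C1_dest:
  fixes f :: "real^4 \<Rightarrow> real"
  assumes "Cn_on 1 f S"
  shows "continuous_on S f" "continuous_on S (partial_deriv i f)" "z \<in> S \<Longrightarrow> f differentiable (at z)"
  using assms Cn_on_SucD[of 0 f S] by (auto simp: partial_deriv_def[abs_def])

lemma continuous_on_delta: "continuous_on S delta"
  by (rule C1_dest[OF C1_delta])

text \<open>Only values and first partial derivatives of C^1 functions enter; second-order
  regularity of the metric is spent here.\<close>

lemma continuous_on_cleared_ricci: "continuous_on S (cleared_ricci b d)"
  unfolding cleared_ricci_def[abs_def]
  by (intro continuous_intros C1_dest[OF C1_delta] C1_dest[OF C1_cleared_christoffel])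

lemma christoffel_eq:
  assumes "delta z \<noteq> 0"
  shows "christoffel G a b c z = cleared_christoffel a b c z / delta z"
  using assms
  unfolding christoffel_def cleared_christoffel_def sum_distrib_left sum_divide_distrib
  by (intro sum.cong refl) (simp add: matrix_inv_cofactors delta_def lowered_christoffel_def)

lemma partial_deriv_christoffel:
  assumes "z \<in> S" "delta z \<noteq> 0"
  shows "partial_deriv e (christoffel G a b c) z =
    (partial_deriv e (cleared_christoffel a b c) z * delta z
      - cleared_christoffel a b c z * partial_deriv e delta z) / (delta z)\<^sup>2"
proof -
  \<comment> \<open>The formula \<open>christoffel_eq\<close> holds only off the zeros of
    \<open>delta\<close>; differentiating it requires an open set of such points.\<close>
  have "open (S \<inter> delta -` (- {0}))"
    using continuous_on_delta open_S by (intro continuous_open_preimage) auto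
  then have "partial_deriv e (christoffel G a b c) z
      = partial_deriv e (\<lambda>w. cleared_christoffel a b c w / delta w) z"
    unfolding partial_deriv_def using assms
    by (subst frechet_derivative_cong_open[of "S \<inter> delta -` (- {0})" z "christoffel G a b c"])
      (auto simp: christoffel_eq)
  then show ?thesis
    using assms partial_deriv_divide[OF C1_dest(3)[OF C1_cleared_christoffel] C1_dest(3)[OF C1_delta]]
    by simp
qed

text \<open>Both the quotient rule and a product of two Christoffel symbols have denominator
  \<open>delta\<close> squared, so one such factor clears every term.\<close>

lemma ricci_eq:
  assumes "z \<in> S" "delta z \<noteq> 0"
  shows "(delta z)\<^sup>2 * ricci G b d z = cleared_ricci b d z"
proof -
  have "(delta z)\<^sup>2 * riemann G a b a d z =
     (partial_deriv a (cleared_christoffel a d b) z * delta z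
       - cleared_christoffel a d b z * partial_deriv a delta z)
     - (partial_deriv d (cleared_christoffel a a b) z * delta z
       - cleared_christoffel a a b z * partial_deriv d delta z)
     + (\<Sum>e\<in>UNIV. cleared_christoffel a a e z * cleared_christoffel e d b z
         - cleared_christoffel a d e z * cleared_christoffel e a b z)" for a
  proof -
    have "(delta z)\<^sup>2 * (x / delta z * (y / delta z) - u / delta z * (w / delta z)) = x * y - u * w"
      for x y u w
      using assms(2) by (simp add: power2_eq_square field_simps)
    then have "(delta z)\<^sup>2 * (\<Sum>e\<in>UNIV. christoffel G a a e z * christoffel G e d b z
                 - christoffel G a d e z * christoffel G e a b z)
       = (\<Sum>e\<in>UNIV. cleared_christoffel a a e z * cleared_christoffel e d b z
         - cleared_christoffel a d e z * cleared_christoffel e a b z)"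
      by (simp add: sum_distrib_left christoffel_eq[OF assms(2)])
    moreover have "(delta z)\<^sup>2 * (x / (delta z)\<^sup>2 - y / (delta z)\<^sup>2 + w) = x - y + (delta z)\<^sup>2 * w" for x y w
      using assms(2) by (simp add: field_simps)
    ultimately show ?thesis
      by (simp only: riemann_def partial_deriv_christoffel[OF assms])
  qed
  then show ?thesis
    by (simp only: ricci_def cleared_ricci_def sum_distrib_left)
qed

text \<open>In dimension 4 the trace of \<open>T\<close> is \<open>s - (1/2) * s * 4 = - s\<close>.
  The factor \<open>delta\<close> turns the inverse metric into the adjugate, so a bound on
  \<open>T\<close> controls \<open>delta\<close> times \<open>s\<close>.\<close>

lemma delta_scalar_curvature:
  assumes "z \<in> S" "delta z \<noteq> 0"
  shows "delta z * scalar_curvature G z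
    = - (\<Sum>a\<in>UNIV. \<Sum>b\<in>UNIV. cofactors (G z) $ b $ a * energy_momentum G a b z)"
proof -
  let ?N = "matrix_inv (G z)" and ?s = "scalar_curvature G z"
  have N: "?N $ a $ b = cofactors (G z) $ b $ a / delta z" for a b
    using assms matrix_inv_cofactors[of "G z"] by (simp add: delta_def)
  \<comment> \<open>The trace of the identity: each row contributes 1, and there are four
    rows.\<close>
  have "(\<Sum>a\<in>UNIV. \<Sum>b\<in>UNIV. ?N $ a $ b * G z $ a $ b) = 4"
  proof -
    have "(\<Sum>b\<in>UNIV. ?N $ a $ b * G z $ a $ b) = 1" for a
    proof -
      have "cofactors (G z) $ b $ a = cofactors (G z) $ a $ b" for b
        using cofactors_sym[OF transpose_G] assms by (simp add: delta_def)
      then have "(\<Sum>b\<in>UNIV. ?N $ a $ b * G z $ a $ b)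
          = (\<Sum>b\<in>UNIV. G z $ a $ b * cofactors (G z) $ a $ b) / delta z"
        by (simp add: N sum_divide_distrib mult.commute)
      then show ?thesis
        using assms(2) by (simp add: cofactors_expansion delta_def)
    qed
    then show ?thesis by simp
  qed
  moreover have "(\<Sum>a\<in>UNIV. \<Sum>b\<in>UNIV. ?N $ a $ b * energy_momentum G a b z)
      = ?s - (1/2) * ?s * (\<Sum>a\<in>UNIV. \<Sum>b\<in>UNIV. ?N $ a $ b * G z $ a $ b)"
  proof -
    have "?N $ a $ b * energy_momentum G a b z
        = ?N $ a $ b * ricci G a b z - (1/2) * ?s * (?N $ a $ b * G z $ a $ b)" for a b
      by (simp add: energy_momentum_def algebra_simps)
    then show ?thesis
      by (simp only: sum_subtractf sum_distrib_left[symmetric] scalar_curvature_def)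
  qed
  ultimately have "?s = - (\<Sum>a\<in>UNIV. \<Sum>b\<in>UNIV. ?N $ a $ b * energy_momentum G a b z)"
    by simp
  then show ?thesis
    using assms(2) by (simp add: N sum_distrib_left)
qed

section \<open>Behaviour at a degenerate point\<close>

lemma partial_deriv_delta:
  assumes "z \<in> S"
  shows "partial_deriv e delta z
    = (\<Sum>i\<in>UNIV. \<Sum>j\<in>UNIV. partial_deriv e (\<lambda>w. G w $ i $ j) z * cofactors (G z) $ i $ j)"
proof -
  have "((\<lambda>w. G w $ i $ j) has_derivative (\<lambda>h. frechet_derivative (\<lambda>w. G w $ i $ j) (at z) h)) (at z)" for i j
    using C1_dest(3)[OF C1_G assms] frechet_derivative_works by blast
  from has_derivative_det[of G, OF this] show ?thesis
    unfolding partial_deriv_def delta_def[abs_def]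
    by (simp add: frechet_derivative_at[symmetric])
qed

lemma partial_deriv_G_sym:
  assumes "z \<in> S"
  shows "partial_deriv e (\<lambda>w. G w $ i $ j) z = partial_deriv e (\<lambda>w. G w $ j $ i) z"
  unfolding partial_deriv_def
  by (rule fun_cong[OF frechet_derivative_cong_open[OF open_S assms]]) (rule sym_G)

text \<open>Otherwise \<open>delta\<close> would vanish on a whole neighbourhood of
  \<open>z0\<close>, and so would its derivative.\<close>

lemma islimpt_nondegenerate:
  assumes "frechet_derivative delta (at z0) \<noteq> (\<lambda>_. 0)" "delta z0 = 0" "open V" "z0 \<in> V"
  shows "z0 islimpt {z \<in> V. delta z \<noteq> 0}"
proof (rule ccontr)
  assume "\<not> ?thesis"
  then obtain N where N: "open N" "z0 \<in> N" "\<And>z. z \<in> N \<Longrightarrow> z \<in> V \<Longrightarrow> z \<noteq> z0 \<Longrightarrow> delta z = 0"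
    by (auto simp: islimpt_def)
  have "frechet_derivative delta (at z0) = frechet_derivative (\<lambda>_. 0) (at z0)"
    by (rule frechet_derivative_cong_open[of "N \<inter> V"]) (use N assms in auto)
  with assms(1) show False by simp
qed

lemma cofactors_rank_one_at:
  assumes "z0 \<in> S" "delta z0 = 0" "frechet_derivative delta (at z0) \<noteq> (\<lambda>_. 0)"
    and "G z0 *v v = 0" "v \<noteq> 0"
  obtains \<kappa> where "\<And>a d. cofactors (G z0) $ a $ d = \<kappa> * v $ a * v $ d"
proof (rule cofactors_rank_one[of "G z0" v])
  have lim: "z0 islimpt {z \<in> S. delta z \<noteq> 0}"
    by (rule islimpt_nondegenerate[OF assms(3,2) open_S assms(1)])
  have cont: "continuous_on S (\<lambda>z. cofactors (G z) $ i $ j)" for i j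
    using Cn_on_cofactors[OF open_S C1_G] C1_dest(1) by blast
  \<comment> \<open>At nondegenerate points the difference is 0 by \<open>cofactors_sym\<close>; the
    limit, taken for both orders of the indices, yields equality at \<open>z0\<close>.\<close>
  have "0 \<le> cofactors (G z0) $ i $ j - cofactors (G z0) $ j $ i" for i j
    by (rule continuous_on_islimpt_nonneg[OF continuous_on_diff[OF cont cont] assms(1) _ lim])
      (auto simp: cofactors_sym[OF transpose_G, of _ i j] delta_def)
  from this[of a d for a d] this[of d a for a d]
  show "cofactors (G z0) $ a $ d = cofactors (G z0) $ d $ a" for a d
    by (meson diff_ge_0_iff_ge order_antisym)
qed (use assms transpose_G that in \<open>auto simp: delta_def\<close>)

text \<open>The terms \<open>K^a_db \<partial>_a\<delta>\<close> and \<open>K^a_ae K^e_db\<close> vanish because \<open>K = cleared_christoffel\<close> has \<open>K^a_bc\<close> proportional to \<open>v^a\<close> and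
  \<open>d\<delta>(v) = 0\<close>; the trace \<open>K^a_ab\<close> is \<open>\<partial>_b\<delta>/2\<close> by Jacobi's formula.\<close>

lemma cleared_ricci_at:
  assumes "z0 \<in> S" "delta z0 = 0" "frechet_derivative delta (at z0) \<noteq> (\<lambda>_. 0)"
    and "G z0 *v v = 0" "v \<noteq> 0" "frechet_derivative delta (at z0) v = 0"
  shows "cleared_ricci b d z0 = (1/4) * partial_deriv b delta z0 * partial_deriv d delta z0"
proof -
  obtain \<kappa> where P: "\<And>a d. cofactors (G z0) $ a $ d = \<kappa> * v $ a * v $ d"
    using cofactors_rank_one_at[OF assms(1-5)] by blast
  define \<delta>' where "\<delta>' e = partial_deriv e delta z0" for e
  define g' where "g' e i j = partial_deriv e (\<lambda>w. G w $ i $ j) z0" for e i j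
  \<comment> \<open>By the rank-one form of the cofactors, the upper index of
    \<open>cleared_christoffel\<close> is carried by \<open>v\<close> alone; \<open>m\<close> is the
    remaining symmetric factor.\<close>
  define m where "m b c = \<kappa> * (\<Sum>d\<in>UNIV. v $ d * lowered_christoffel d b c z0)" for b c
  have dv: "(\<Sum>e\<in>UNIV. v $ e * \<delta>' e) = 0"
    using frechet_derivative_partial[OF C1_dest(3)[OF C1_delta assms(1)], of v] assms(6)
    by (simp add: \<delta>'_def)
  have K: "cleared_christoffel a b c z0 = v $ a * m b c" for a b c
    by (simp add: cleared_christoffel_def P m_def sum_distrib_left mult_ac)
  have low: "lowered_christoffel d b c z0 = (1/2) * (g' b d c + g' c d b - g' d b c)" for b c d
    by (simp add: lowered_christoffel_def g'_def)
  have g'_sym: "g' e i j = g' e j i" for e i j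
    using partial_deriv_G_sym[OF assms(1)] by (simp add: g'_def)
  have m_sym: "m b c = m c b" for b c
    by (simp add: m_def low g'_sym[of _ b c] add.commute)
  \<comment> \<open>Two of the three derivative terms cancel after exchanging \<open>a\<close> and
    \<open>d\<close>; the third is half of the Jacobi sum for \<open>\<delta>' b\<close>.\<close>
  have tr: "(\<Sum>a\<in>UNIV. v $ a * m a b) = \<delta>' b / 2" for b
  proof -
    have "(\<Sum>a\<in>UNIV. v $ a * m a b)
        = (\<Sum>a\<in>UNIV. \<Sum>d\<in>UNIV. \<kappa> / 2 * (v $ a * v $ d * (g' a d b + g' b d a - g' d a b)))"
      by (simp add: m_def low sum_distrib_left mult_ac)
    also have "\<dots> = \<kappa> / 2 * ((\<Sum>a\<in>UNIV. \<Sum>d\<in>UNIV. v $ a * v $ d * g' b d a)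
        + ((\<Sum>a\<in>UNIV. \<Sum>d\<in>UNIV. v $ a * v $ d * g' a d b)
          - (\<Sum>a\<in>UNIV. \<Sum>d\<in>UNIV. v $ a * v $ d * g' d a b)))"
      by (simp add: sum_distrib_left sum.distrib sum_subtractf algebra_simps)
    also have "(\<Sum>a\<in>UNIV. \<Sum>d\<in>UNIV. v $ a * v $ d * g' a d b)
        = (\<Sum>a\<in>UNIV. \<Sum>d\<in>UNIV. v $ a * v $ d * g' d a b)"
      by (subst sum.swap) (simp add: mult.commute)
    also have "\<kappa> / 2 * ((\<Sum>a\<in>UNIV. \<Sum>d\<in>UNIV. v $ a * v $ d * g' b d a)
        + ((\<Sum>a\<in>UNIV. \<Sum>d\<in>UNIV. v $ a * v $ d * g' d a b)
          - (\<Sum>a\<in>UNIV. \<Sum>d\<in>UNIV. v $ a * v $ d * g' d a b))) = \<delta>' b / 2"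
      unfolding \<delta>'_def partial_deriv_delta[OF assms(1)] P g'_def[symmetric]
      by (simp add: g'_sym[of b] sum_distrib_left sum_divide_distrib mult_ac)
    finally show ?thesis .
  qed
  have "(\<Sum>a\<in>UNIV. v $ a * m d b * \<delta>' a) = (\<Sum>a\<in>UNIV. v $ a * \<delta>' a) * m d b"
    by (simp only: sum_distrib_right) (simp add: mult_ac)
  then have 1: "(\<Sum>a\<in>UNIV. v $ a * m d b * \<delta>' a) = 0"
    by (simp add: dv)
  have 2: "(\<Sum>a\<in>UNIV. v $ a * m a b * \<delta>' d) = \<delta>' b * \<delta>' d / 2"
    using tr[of b] by (simp add: sum_distrib_right[symmetric])
  have "(\<Sum>a\<in>UNIV. \<Sum>e\<in>UNIV. v $ a * m a e * (v $ e * m d b))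
      = (\<Sum>e\<in>UNIV. (\<Sum>a\<in>UNIV. v $ a * m a e) * (v $ e * m d b))"
    by (subst sum.swap) (simp only: sum_distrib_right)
  also have "\<dots> = (\<Sum>e\<in>UNIV. v $ e * \<delta>' e) * (m d b / 2)"
    by (simp only: tr sum_distrib_right) (simp add: mult_ac)
  finally have 3: "(\<Sum>a\<in>UNIV. \<Sum>e\<in>UNIV. v $ a * m a e * (v $ e * m d b)) = 0"
    by (simp add: dv)
  \<comment> \<open>Symmetry of \<open>m\<close> separates the double sum into a product of two
    traces, each given by \<open>tr\<close>.\<close>
  have "(\<Sum>a\<in>UNIV. \<Sum>e\<in>UNIV. v $ a * m d e * (v $ e * m a b))
      = (\<Sum>a\<in>UNIV. v $ a * m a b) * (\<Sum>e\<in>UNIV. v $ e * m e d)"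
    by (simp add: sum_product m_sym[of d] mult_ac)
  then have 4: "(\<Sum>a\<in>UNIV. \<Sum>e\<in>UNIV. v $ a * m d e * (v $ e * m a b)) = \<delta>' b * \<delta>' d / 4"
    by (simp add: tr)
  \<comment> \<open>Every term with a factor \<open>delta z0\<close> drops out; the surviving
    coefficients are \<open>1/2 - 1/4 = 1/4\<close>.\<close>
  have "cleared_ricci b d z0 = - (\<Sum>a\<in>UNIV. v $ a * m d b * \<delta>' a) + (\<Sum>a\<in>UNIV. v $ a * m a b * \<delta>' d)
      + ((\<Sum>a\<in>UNIV. \<Sum>e\<in>UNIV. v $ a * m a e * (v $ e * m d b))
        - (\<Sum>a\<in>UNIV. \<Sum>e\<in>UNIV. v $ a * m d e * (v $ e * m a b)))"
    by (simp add: cleared_ricci_def K assms(2) \<delta>'_def[symmetric] sum.distrib sum_subtractf sum_negf)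
  then show ?thesis
    unfolding 1 2 3 4 by (simp add: \<delta>'_def)
qed

text \<open>A bound on \<open>T\<close> would force the continuous extension of \<open>delta\<close>
  squared times Ric to vanish at \<open>z0\<close>, against \<open>cleared_ricci_at\<close>.\<close>

lemma energy_momentum_unbounded:
  assumes "z0 \<in> S" "delta z0 = 0" "frechet_derivative delta (at z0) \<noteq> (\<lambda>_. 0)"
    and "G z0 *v v = 0" "v \<noteq> 0" "frechet_derivative delta (at z0) v = 0"
    and "open V" "z0 \<in> V" "V \<subseteq> S"
  shows "\<exists>z\<in>V. delta z \<noteq> 0 \<and> (\<exists>a b. \<bar>energy_momentum G a b z\<bar> > B)"
proof (rule ccontr)
  assume "\<not> ?thesis"
  then have T: "\<bar>energy_momentum G a b z\<bar> \<le> B" if "z \<in> V" "delta z \<noteq> 0" for a b z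
    using that by (auto simp: not_less)
  have lim: "z0 islimpt {z \<in> V. delta z \<noteq> 0}"
    by (rule islimpt_nondegenerate[OF assms(3,2,7,8)])
  have contG: "continuous_on S (\<lambda>z. G z $ i $ j)" for i j
    using C1_G C1_dest(1) by blast
  have contP: "continuous_on S (\<lambda>z. cofactors (G z) $ i $ j)" for i j
    using Cn_on_cofactors[OF open_S C1_G] C1_dest(1) by blast
  have "cleared_ricci b d z0 = 0" for b d
  proof -
    \<comment> \<open>A continuous majorant of \<open>cleared_ricci\<close> at nondegenerate points,
      built from the bound \<open>B\<close>; each summand has a factor \<open>delta\<close>, hence
      \<open>h z0 = 0\<close>.\<close>
    define h where "h z = (delta z)\<^sup>2 * B + (1/2) * \<bar>delta z\<bar> *
      (\<Sum>i\<in>UNIV. \<Sum>j\<in>UNIV. \<bar>cofactors (G z) $ j $ i\<bar> * B) * \<bar>G z $ b $ d\<bar>" for z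
    have bound: "\<bar>cleared_ricci b d z\<bar> \<le> h z" if z: "z \<in> V" "delta z \<noteq> 0" for z
    proof -
      let ?PT = "\<Sum>i\<in>UNIV. \<Sum>j\<in>UNIV. cofactors (G z) $ j $ i * energy_momentum G i j z"
      have zS: "z \<in> S" using z assms by blast
      have "cleared_ricci b d z = (delta z)\<^sup>2 * energy_momentum G b d z
          + (1/2) * delta z * (delta z * scalar_curvature G z) * G z $ b $ d"
        unfolding ricci_eq[OF zS z(2), symmetric]
        by (simp add: energy_momentum_def power2_eq_square algebra_simps)
      also have "\<dots> = (delta z)\<^sup>2 * energy_momentum G b d z - (1/2) * delta z * ?PT * G z $ b $ d"
        unfolding delta_scalar_curvature[OF zS z(2)] by simp
      also have "\<bar>\<dots>\<bar> \<le> \<bar>(delta z)\<^sup>2 * energy_momentum G b d z\<bar> + \<bar>(1/2) * delta z * ?PT * G z $ b $ d\<bar>"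
        by (rule abs_triangle_ineq4)
      also have "\<dots> = (delta z)\<^sup>2 * \<bar>energy_momentum G b d z\<bar> + (1/2) * \<bar>delta z\<bar> * \<bar>?PT\<bar> * \<bar>G z $ b $ d\<bar>"
        by (simp add: abs_mult)
      also have "\<dots> \<le> h z"
      proof -
        have "\<bar>?PT\<bar> \<le> (\<Sum>i\<in>UNIV. \<Sum>j\<in>UNIV. \<bar>cofactors (G z) $ j $ i\<bar> * B)"
          by (intro order_trans[OF sum_abs] sum_mono order_trans[OF sum_abs])
            (simp add: abs_mult mult_left_mono T z)
        then show ?thesis
          unfolding h_def
          by (intro add_mono mult_left_mono mult_right_mono T z) auto
      qed
      finally show ?thesis .
    qed
    have "continuous_on S (\<lambda>z. h z - \<bar>cleared_ricci b d z\<bar>)"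
      unfolding h_def
      by (intro continuous_intros contG contP continuous_on_delta continuous_on_cleared_ricci)
    then have "0 \<le> h z0 - \<bar>cleared_ricci b d z0\<bar>"
      by (rule continuous_on_islimpt_nonneg[OF _ assms(1) _ lim]) (use bound assms(9) in auto)
    then show ?thesis
      by (simp add: h_def assms(2))
  qed
  \<comment> \<open>On the diagonal the value at \<open>z0\<close> is a quarter of a square.\<close>
  then have "partial_deriv b delta z0 = 0" for b
    using cleared_ricci_at[OF assms(1-6), of b b] by simp
  then have "frechet_derivative delta (at z0) = (\<lambda>_. 0)"
    using frechet_derivative_partial[OF C1_dest(3)[OF C1_delta assms(1)]] by auto
  with assms(3) show False by simp
qed

end

section \<open>Tensor fields in charts\<close>

abbreviation jacobian :: "'m chart \<Rightarrow> 'm chart \<Rightarrow> 'm \<Rightarrow> real^4 \<Rightarrow> real^4" where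
  "jacobian c c' y \<equiv> frechet_derivative (transition c c') (at (cmap c y))"

locale tensor_field_on_manifold =
  fixes A :: "'m::{t2_space, second_countable_topology} chart set"
    and g :: "'m \<Rightarrow> 'm tvec \<Rightarrow> 'm tvec \<Rightarrow> real"
  assumes smooth: "smooth_structure A"
    and bilinear: "symmetric_bilinear_field A g"
begin

section \<open>Charts, transition maps and their Jacobians\<close>

lemma chart: "c \<in> A \<Longrightarrow> is_chart c"
  using smooth by (auto simp: smooth_structure_def)

lemma charts_atD: "c \<in> charts_at A y \<Longrightarrow> c \<in> A" "c \<in> charts_at A y \<Longrightarrow> y \<in> cdom c"
  by (auto simp: charts_at_def)

lemma cinv_cmap: "c \<in> A \<Longrightarrow> y \<in> cdom c \<Longrightarrow> cinv c (cmap c y) = y"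
  using chart[of c] by (auto simp: is_chart_def homeomorphism_def)

lemma transition_cmap: "c \<in> A \<Longrightarrow> y \<in> cdom c \<Longrightarrow> transition c c' (cmap c y) = cmap c' y"
  by (simp add: transition_def cinv_cmap)

lemma open_chart_image:
  assumes "c \<in> A" "open U"
  shows "open (cmap c ` (cdom c \<inter> U))"
proof -
  have c: "open (cimage c)" "homeomorphism (cdom c) (cimage c) (cmap c) (cinv c)"
    using chart[OF assms(1)] by (auto simp: is_chart_def)
  have "openin (top_of_set (cimage c)) (cmap c ` (cdom c \<inter> U))"
    by (rule homeomorphism_imp_open_map[OF c(2)]) (use assms(2) in \<open>auto simp: openin_open\<close>)
  with c(1) show ?thesis
    using openin_open_trans by blast
qed

lemma open_overlap: "c \<in> A \<Longrightarrow> c' \<in> A \<Longrightarrow> open (cmap c ` (cdom c \<inter> cdom c'))"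
  using open_chart_image chart by (auto simp: is_chart_def)

lemma Cn_on_transition:
  assumes "c \<in> A" "c' \<in> A"
  shows "Cn_on n (transition c c') (cmap c ` (cdom c \<inter> cdom c'))"
proof -
  have "smoothly_compatible c c'"
    using smooth assms unfolding smooth_structure_def by blast
  then show ?thesis
    by (simp add: smoothly_compatible_def Ck_on_def)
qed

lemma in_overlap: "c \<in> charts_at A y \<Longrightarrow> c' \<in> charts_at A y \<Longrightarrow> cmap c y \<in> cmap c ` (cdom c \<inter> cdom c')"
  by (auto simp: charts_at_def)

lemma has_derivative_transition:
  assumes "c \<in> charts_at A y" "c' \<in> charts_at A y"
  shows "(transition c c' has_derivative jacobian c c' y) (at (cmap c y))"
proof -
  have "\<forall>z\<in>cmap c ` (cdom c \<inter> cdom c'). transition c c' differentiable (at z)"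
    using Cn_on_transition[of c c' "Suc 0"] charts_atD(1) assms unfolding Cn_on.simps by blast
  then show ?thesis
    using in_overlap[OF assms] frechet_derivative_works by blast
qed

lemma linear_jacobian: "c \<in> charts_at A y \<Longrightarrow> c' \<in> charts_at A y \<Longrightarrow> linear (jacobian c c' y)"
  using has_derivative_linear has_derivative_transition by blast

text \<open>\<open>transition c c\<close> agrees with the identity only on the chart image, which
  suffices because that image is open.\<close>

lemma jacobian_self:
  assumes "c \<in> charts_at A y"
  shows "jacobian c c y u = u"
proof -
  have "jacobian c c y = frechet_derivative (\<lambda>z. z) (at (cmap c y))"
    by (rule frechet_derivative_cong_open[OF open_overlap[of c c]])
      (use assms in_overlap[of c y c] in \<open>auto simp: charts_at_def transition_cmap\<close>)
  then show ?thesis by simp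
qed

text \<open>The cocycle identity: chain rule on the triple overlap. It is what makes coordinate
  vectors obey the transformation law.\<close>

lemma jacobian_trans:
  assumes "c \<in> charts_at A y" "c' \<in> charts_at A y" "c'' \<in> charts_at A y"
  shows "jacobian c' c'' y (jacobian c c' y u) = jacobian c c'' y u"
proof -
  let ?W = "cmap c ` (cdom c \<inter> (cdom c' \<inter> cdom c''))"
  have cA: "c \<in> A" "c' \<in> A" "c'' \<in> A" and yc: "y \<in> cdom c" "y \<in> cdom c'" "y \<in> cdom c''"
    using assms charts_atD by blast+
  have "((\<lambda>z. transition c' c'' (transition c c' z)) has_derivative
      (\<lambda>u. jacobian c' c'' y (jacobian c c' y u))) (at (cmap c y))"
    by (rule has_derivative_compose[OF has_derivative_transition[OF assms(1,2)]])
      (simp add: transition_cmap cA yc has_derivative_transition[OF assms(2,3)])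
  then have "(\<lambda>u. jacobian c' c'' y (jacobian c c' y u))
      = frechet_derivative (\<lambda>z. transition c' c'' (transition c c' z)) (at (cmap c y))"
    by (rule frechet_derivative_at)
  also have "\<dots> = jacobian c c'' y"
  proof (rule frechet_derivative_cong_open)
    show "open ?W"
      using open_chart_image[OF cA(1)] chart[OF cA(2)] chart[OF cA(3)]
      by (simp add: is_chart_def open_Int)
    show "cmap c y \<in> ?W" using yc by auto
    show "transition c' c'' (transition c c' z) = transition c c'' z" if "z \<in> ?W" for z
      using that cA by (auto simp: transition_cmap)
  qed
  finally show ?thesis by metis
qed

section \<open>Tangent vectors in coordinates\<close>

lemma coord_vec_in_tangent_space:
  "c \<in> charts_at A y \<Longrightarrow> coord_vec A c y i \<in> tangent_space A y"
  by (simp add: tangent_space_def coord_vec_def jacobian_trans)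

lemma coord_vec_self: "c \<in> charts_at A y \<Longrightarrow> coord_vec A c y i c = axis i 1"
  by (simp add: coord_vec_def jacobian_self)

lemma tangent_space_jacobian:
  "v \<in> tangent_space A y \<Longrightarrow> c \<in> charts_at A y \<Longrightarrow> c' \<in> charts_at A y \<Longrightarrow> v c' = jacobian c c' y (v c)"
  unfolding tangent_space_def by blast

lemma tangent_space_outside:
  "v \<in> tangent_space A y \<Longrightarrow> c \<notin> charts_at A y \<Longrightarrow> v c = 0"
  unfolding tangent_space_def by blast

lemma zero_in_tangent_space: "(\<lambda>_. 0) \<in> tangent_space A y"
  by (auto simp: tangent_space_def linear_0 linear_jacobian)

lemma combination_in_tangent_space:
  assumes "u \<in> tangent_space A y" "v \<in> tangent_space A y"
  shows "(\<lambda>c. a *\<^sub>R u c + b *\<^sub>R v c) \<in> tangent_space A y"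
  unfolding tangent_space_def mem_Collect_eq
proof (intro conjI ballI allI impI)
  fix c c' assume c: "c \<in> charts_at A y" "c' \<in> charts_at A y"
  then show "a *\<^sub>R u c' + b *\<^sub>R v c' = jacobian c c' y (a *\<^sub>R u c + b *\<^sub>R v c)"
    by (simp add: linear_add linear_scale linear_jacobian
        tangent_space_jacobian[OF assms(1) c] tangent_space_jacobian[OF assms(2) c])
qed (simp add: tangent_space_outside[OF assms(1)] tangent_space_outside[OF assms(2)])

lemma sum_in_tangent_space:
  assumes "\<And>i. i \<in> I \<Longrightarrow> e i \<in> tangent_space A y"
  shows "(\<lambda>c. \<Sum>i\<in>I. a i *\<^sub>R e i c) \<in> tangent_space A y"
  using assms
proof (induction I rule: infinite_finite_induct)
  case (insert i I)
  then have "(\<lambda>c. a i *\<^sub>R e i c + 1 *\<^sub>R (\<Sum>i\<in>I. a i *\<^sub>R e i c)) \<in> tangent_space A y"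
    by (intro combination_in_tangent_space) auto
  with insert show ?case by simp
qed (auto intro: zero_in_tangent_space)

lemma metric_linear:
  assumes "u \<in> tangent_space A y" "v \<in> tangent_space A y" "w \<in> tangent_space A y"
  shows "g y (\<lambda>c. a *\<^sub>R u c + b *\<^sub>R v c) w = a * g y u w + b * g y v w"
  using bilinear assms unfolding symmetric_bilinear_field_def by blast

lemma metric_zero:
  assumes "w \<in> tangent_space A y"
  shows "g y (\<lambda>_. 0) w = 0"
  using metric_linear[OF assms assms assms, of 0 0] by simp

lemma metric_sum:
  assumes "\<And>i. i \<in> I \<Longrightarrow> e i \<in> tangent_space A y" "w \<in> tangent_space A y"
  shows "g y (\<lambda>c. \<Sum>i\<in>I. a i *\<^sub>R e i c) w = (\<Sum>i\<in>I. a i * g y (e i) w)"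
  using assms(1)
proof (induction I rule: infinite_finite_induct)
  case (insert i I)
  have "g y (\<lambda>c. a i *\<^sub>R e i c + 1 *\<^sub>R (\<Sum>i\<in>I. a i *\<^sub>R e i c)) w
      = a i * g y (e i) w + 1 * g y (\<lambda>c. \<Sum>i\<in>I. a i *\<^sub>R e i c) w"
    by (intro metric_linear sum_in_tangent_space assms(2)) (use insert.prems in auto)
  with insert show ?case by simp
qed (use assms(2) metric_zero in auto)

lemma metric_commute:
  "u \<in> tangent_space A y \<Longrightarrow> v \<in> tangent_space A y \<Longrightarrow> g y u v = g y v u"
  using bilinear unfolding symmetric_bilinear_field_def by blast

text \<open>On charts around \<open>y\<close> this is linearity of the Jacobian; on all others both
  sides take the default value 0.\<close>

lemma tangent_vector_expansion:
  assumes "v \<in> tangent_space A y" "c \<in> charts_at A y"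
  shows "v = (\<lambda>c'. \<Sum>i\<in>UNIV. v c $ i *\<^sub>R coord_vec A c y i c')"
proof
  fix c'
  show "v c' = (\<Sum>i\<in>UNIV. v c $ i *\<^sub>R coord_vec A c y i c')"
  proof (cases "c' \<in> charts_at A y")
    case True
    then show ?thesis
      using linear_axis_expansion[OF linear_jacobian[OF assms(2) True], of "v c"]
        tangent_space_jacobian[OF assms True]
      by (simp add: coord_vec_def)
  next
    case False
    then show ?thesis
      using tangent_space_outside[OF assms(1)] by (simp add: coord_vec_def)
  qed
qed

lemma tangent_vector_eq_zero_iff:
  assumes "v \<in> tangent_space A y" "c \<in> charts_at A y"
  shows "v = (\<lambda>_. 0) \<longleftrightarrow> v c = 0"
proof
  assume "v c = 0"
  then have "(\<lambda>c'. \<Sum>i\<in>UNIV. v c $ i *\<^sub>R coord_vec A c y i c') = (\<lambda>_. 0)"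
    by simp
  with tangent_vector_expansion[OF assms] show "v = (\<lambda>_. 0)"
    by (rule trans)
qed simp

text \<open>Together with \<open>tangent_vector_eq_zero_iff\<close> this identifies the tangent
  space with \<open>real^4\<close> through a single chart.\<close>

lemma obtain_tangent_vector:
  assumes "c \<in> charts_at A y"
  obtains v where "v \<in> tangent_space A y" "v c = w"
proof
  let ?v = "\<lambda>c'. \<Sum>i\<in>UNIV. w $ i *\<^sub>R coord_vec A c y i c'"
  show "?v \<in> tangent_space A y"
    using assms by (intro sum_in_tangent_space coord_vec_in_tangent_space)
  show "?v c = w"
    using linear_axis_expansion[OF linear_ident, of w, symmetric]
    by (simp add: coord_vec_self[OF assms])
qed

section \<open>The metric and its radical as a matrix and its kernel\<close>

lemma metric_components_cmap:
  assumes "c \<in> charts_at A y"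
  shows "metric_components A g c (cmap c y) $ i $ j = g y (coord_vec A c y i) (coord_vec A c y j)"
  using charts_atD[OF assms] by (simp add: metric_components_def cinv_cmap)

lemma transpose_metric_components:
  assumes "c \<in> charts_at A y"
  shows "transpose (metric_components A g c (cmap c y)) = metric_components A g c (cmap c y)"
proof -
  have "metric_components A g c (cmap c y) $ i $ j = metric_components A g c (cmap c y) $ j $ i" for i j
    unfolding metric_components_cmap[OF assms]
    by (intro metric_commute coord_vec_in_tangent_space assms)
  then show ?thesis
    by (simp only: Finite_Cartesian_Product.transpose_def vec_eq_iff vec_lambda_beta) blast
qed

lemma metric_eq_components:
  assumes "u \<in> tangent_space A y" "w \<in> tangent_space A y" "c \<in> charts_at A y"
  shows "g y u w = u c \<bullet> (metric_components A g c (cmap c y) *v w c)"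
proof -
  let ?E = "coord_vec A c y"
  note E = coord_vec_in_tangent_space[OF assms(3)]
  have right: "g y (?E i) w = (\<Sum>j\<in>UNIV. w c $ j * g y (?E i) (?E j))" for i
  proof -
    \<comment> \<open>Linearity is assumed in the first argument, so symmetry moves \<open>w\<close>
      there and afterwards the basis vectors back.\<close>
    have "g y (?E i) w = g y w (?E i)"
      using metric_commute E assms(2) by blast
    also have "\<dots> = g y (\<lambda>c'. \<Sum>j\<in>UNIV. w c $ j *\<^sub>R ?E j c') (?E i)"
      using tangent_vector_expansion[OF assms(2,3)] by (rule arg_cong)
    also have "\<dots> = (\<Sum>j\<in>UNIV. w c $ j * g y (?E j) (?E i))"
      by (rule metric_sum[OF E E])
    also have "\<dots> = (\<Sum>j\<in>UNIV. w c $ j * g y (?E i) (?E j))"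
      using metric_commute[OF E E] by (intro sum.cong refl) simp
    finally show ?thesis .
  qed
  have "g y u w = g y (\<lambda>c'. \<Sum>i\<in>UNIV. u c $ i *\<^sub>R ?E i c') w"
    using tangent_vector_expansion[OF assms(1,3)] by (rule arg_cong)
  also have "\<dots> = (\<Sum>i\<in>UNIV. u c $ i * g y (?E i) w)"
    by (rule metric_sum[OF E assms(2)])
  also have "\<dots> = u c \<bullet> (metric_components A g c (cmap c y) *v w c)"
    by (simp add: right inner_vec_def matrix_vector_mult_def metric_components_cmap[OF assms(3)] mult.commute)
  finally show ?thesis .
qed

lemma metric_radical_iff:
  assumes "v \<in> tangent_space A y" "c \<in> charts_at A y"
  shows "v \<in> metric_radical A g y \<longleftrightarrow> metric_components A g c (cmap c y) *v v c = 0" (is "_ \<longleftrightarrow> ?M = 0")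
proof
  assume v: "v \<in> metric_radical A g y"
  \<comment> \<open>Testing \<open>v\<close> against the tangent vector with coordinates
    \<open>?M\<close> makes the pairing the squared norm of \<open>?M\<close>.\<close>
  obtain w where w: "w \<in> tangent_space A y" "w c = ?M"
    by (rule obtain_tangent_vector[OF assms(2)])
  have "?M \<bullet> ?M = g y w v"
    using metric_eq_components[OF w(1) assms] w(2) by simp
  also have "\<dots> = 0"
    using v w(1) metric_commute[OF w(1) assms(1)] by (simp add: metric_radical_def)
  finally show "?M = 0" by simp
next
  assume "?M = 0"
  then have "g y w v = 0" if "w \<in> tangent_space A y" for w
    using metric_eq_components[OF that assms] by simp
  then show "v \<in> metric_radical A g y"
    using assms(1) metric_commute[OF assms(1)] by (simp add: metric_radical_def)
qed

lemma degenerate_set_iff_vector: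
  "y \<in> degenerate_set A g \<longleftrightarrow> (\<exists>v\<in>metric_radical A g y. v \<noteq> (\<lambda>_. 0))"
proof -
  have "(\<lambda>_. 0) \<in> metric_radical A g y"
    using metric_zero zero_in_tangent_space by (simp add: metric_radical_def)
  then show ?thesis
    unfolding degenerate_set_def by blast
qed

lemma degenerate_set_iff_det:
  assumes "c \<in> charts_at A y"
  shows "y \<in> degenerate_set A g \<longleftrightarrow> det (metric_components A g c (cmap c y)) = 0"
proof -
  let ?M = "metric_components A g c (cmap c y)"
  have "y \<in> degenerate_set A g \<longleftrightarrow> (\<exists>w. ?M *v w = 0 \<and> w \<noteq> 0)"
  proof
    assume "y \<in> degenerate_set A g"
    then obtain v where v: "v \<in> metric_radical A g y" "v \<noteq> (\<lambda>_. 0)"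
      by (auto simp: degenerate_set_iff_vector)
    then have "v \<in> tangent_space A y" by (simp add: metric_radical_def)
    with v assms show "\<exists>w. ?M *v w = 0 \<and> w \<noteq> 0"
      using metric_radical_iff tangent_vector_eq_zero_iff by blast
  next
    assume "\<exists>w. ?M *v w = 0 \<and> w \<noteq> 0"
    then obtain w where w: "?M *v w = 0" "w \<noteq> 0" by blast
    obtain v where v: "v \<in> tangent_space A y" "v c = w"
      by (rule obtain_tangent_vector[OF assms])
    have "v \<in> metric_radical A g y"
      using metric_radical_iff[OF v(1) assms] w v(2) by simp
    moreover have "v \<noteq> (\<lambda>_. 0)" using v w by auto
    ultimately show "y \<in> degenerate_set A g"
      by (auto simp: degenerate_set_iff_vector)
  qed
  also have "\<dots> \<longleftrightarrow> det ?M = 0"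
    using invertible_det_nz[of ?M] invertible_left_inverse[of ?M] matrix_left_invertible_ker[of ?M]
    by blast
  finally show ?thesis .
qed

section \<open>The differential of the determinant: change of chart and tangent directions\<close>

lemma det_metric_components_transition:
  assumes "c \<in> charts_at A y" "c' \<in> charts_at A y"
  shows "det (metric_components A g c (cmap c y))
    = (det (\<chi> i k. jacobian c c' y (axis i 1) $ k))\<^sup>2 * det (metric_components A g c' (cmap c' y))"
proof -
  let ?J = "\<chi> i k. jacobian c c' y (axis i 1) $ k" and ?M' = "metric_components A g c' (cmap c' y)"
  \<comment> \<open>The rows of \<open>?J\<close> are the coordinate vectors of \<open>c\<close>
    seen in \<open>c'\<close>, so changing charts is a congruence by \<open>?J\<close> and the
    determinant gains \<open>det ?J\<close> squared.\<close>
  have J: "coord_vec A c y i c' = ?J $ i" for i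
    using assms by (simp add: coord_vec_def vec_eq_iff)
  have "metric_components A g c (cmap c y) $ i $ j = (?J ** (?M' ** transpose ?J)) $ i $ j" for i j
  proof -
    have "metric_components A g c (cmap c y) $ i $ j = ?J $ i \<bullet> (?M' *v ?J $ j)"
      unfolding metric_components_cmap[OF assms(1)] J[symmetric]
      by (intro metric_eq_components coord_vec_in_tangent_space assms)
    also have "\<dots> = (?J ** (?M' ** transpose ?J)) $ i $ j"
      by (simp add: matrix_matrix_mult_def matrix_vector_mult_def inner_vec_def
          Finite_Cartesian_Product.transpose_def)
    finally show ?thesis .
  qed
  then have "metric_components A g c (cmap c y) = ?J ** (?M' ** transpose ?J)"
    by (simp add: vec_eq_iff)
  then show ?thesis
    by (simp add: det_mul power2_eq_square)
qed

text \<open>The matrix entries are first derivatives of a smooth map, hence differentiable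
  themselves; Jacobi's formula passes this on to the determinant.\<close>

lemma differentiable_det_jacobian:
  assumes "c \<in> charts_at A y" "c' \<in> charts_at A y"
  shows "(\<lambda>z. det (\<chi> i k. frechet_derivative (transition c c') (at z) (axis i 1) $ k))
    differentiable (at (cmap c y))"
proof -
  have "\<forall>z\<in>cmap c ` (cdom c \<inter> cdom c').
      (\<lambda>z. frechet_derivative (transition c c') (at z) (axis i 1)) differentiable (at z)" for i
    using Cn_on_transition[of c c' "Suc (Suc 0)"] charts_atD(1) assms unfolding Cn_on.simps by blast
  then have "((\<lambda>z. frechet_derivative (transition c c') (at z) (axis i 1)) has_derivative
      frechet_derivative (\<lambda>z. frechet_derivative (transition c c') (at z) (axis i 1)) (at (cmap c y)))
      (at (cmap c y))" for i
    using in_overlap[OF assms] frechet_derivative_works by blast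
  from has_derivative_compose[OF this bounded_linear_imp_has_derivative[OF bounded_linear_vec_nth]]
  have "((\<lambda>z. (\<chi> i k. frechet_derivative (transition c c') (at z) (axis i 1) $ k) $ i $ k) has_derivative
      (\<lambda>h. frechet_derivative (\<lambda>z. frechet_derivative (transition c c') (at z) (axis i 1)) (at (cmap c y)) h $ k))
      (at (cmap c y))" for i k
    by simp
  from has_derivative_det[OF this] show ?thesis
    unfolding differentiable_def by blast
qed

text \<open>At a zero of the determinant the derivative of the Jacobian factor does not contribute.\<close>

lemma frechet_derivative_det_transfer:
  assumes "c \<in> charts_at A y" "c' \<in> charts_at A y" "y \<in> degenerate_set A g"
    and "(\<lambda>z. det (metric_components A g c' z)) differentiable (at (cmap c' y))"
    and "frechet_derivative (\<lambda>z. det (metric_components A g c' z)) (at (cmap c' y)) = (\<lambda>_. 0)"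
  shows "frechet_derivative (\<lambda>z. det (metric_components A g c z)) (at (cmap c y)) = (\<lambda>_. 0)"
proof -
  let ?W = "cmap c ` (cdom c \<inter> cdom c')"
  let ?a = "\<lambda>z. (det (\<chi> i k. frechet_derivative (transition c c') (at z) (axis i 1) $ k))\<^sup>2"
  let ?d = "\<lambda>z. det (metric_components A g c' (transition c c' z))"
  have cA: "c \<in> A" "c' \<in> A" and yc: "y \<in> cdom c"
    using assms charts_atD by blast+
  obtain a' where a': "(?a has_derivative a') (at (cmap c y))"
    using differentiable_power[OF differentiable_det_jacobian[OF assms(1,2)]]
    unfolding differentiable_def by blast
  have d0: "((\<lambda>z. det (metric_components A g c' z)) has_derivative (\<lambda>_. 0)) (at (transition c c' (cmap c y)))"
    using assms(4,5) frechet_derivative_works by (metis transition_cmap[OF cA(1) yc])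
  have d': "(?d has_derivative (\<lambda>_. 0)) (at (cmap c y))"
    by (rule has_derivative_compose[OF has_derivative_transition[OF assms(1,2)] d0])
  have zero: "?d (cmap c y) = 0"
    using assms(2,3) degenerate_set_iff_det by (simp add: transition_cmap[OF cA(1) yc])
  have "((\<lambda>z. ?a z * ?d z) has_derivative (\<lambda>_. 0)) (at (cmap c y))"
    using has_derivative_mult[OF a' d'] unfolding zero by simp
  moreover have "?a z * ?d z = det (metric_components A g c z)" if z: "z \<in> ?W" for z
  proof -
    obtain p where p: "z = cmap c p" "p \<in> cdom c" "p \<in> cdom c'"
      using z by blast
    then have "c \<in> charts_at A p" "c' \<in> charts_at A p"
      using cA by (auto simp: charts_at_def)
    from det_metric_components_transition[OF this] show ?thesis
      using p cA by (simp add: transition_cmap)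
  qed
  ultimately have "((\<lambda>z. det (metric_components A g c z)) has_derivative (\<lambda>_. 0)) (at (cmap c y))"
    by (rule has_derivative_transform_within_open[OF _ open_overlap[OF cA] in_overlap[OF assms(1,2)]])
  then show ?thesis
    by (simp add: frechet_derivative_at[symmetric])
qed

text \<open>The determinant vanishes along a curve inside the degenerate set, so the chain rule
  kills its derivative in the direction of the velocity. The curve may be given in a chart other
  than \<open>c\<close>.\<close>

lemma frechet_derivative_det_tangent:
  assumes "v \<in> hypersurface_tangent_space A (degenerate_set A g) y" "c \<in> charts_at A y"
    and "(\<lambda>z. det (metric_components A g c z)) differentiable (at (cmap c y))"
  shows "frechet_derivative (\<lambda>z. det (metric_components A g c z)) (at (cmap c y)) (v c) = 0"
proof -
  let ?det = "\<lambda>z. det (metric_components A g c z)"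
  obtain c1 \<gamma> \<epsilon> where c1: "c1 \<in> charts_at A y" and "\<epsilon> > 0" "\<gamma> 0 = y"
    and \<gamma>: "\<gamma> ` {-\<epsilon><..<\<epsilon>} \<subseteq> degenerate_set A g \<inter> cdom c1"
    and C1: "Ck_on 1 (cmap c1 \<circ> \<gamma>) {-\<epsilon><..<\<epsilon>}"
    and \<gamma>': "((cmap c1 \<circ> \<gamma>) has_vector_derivative v c1) (at 0)"
    and v: "v \<in> tangent_space A y"
    using assms(1) unfolding hypersurface_tangent_space_def by blast
  let ?W = "cmap c1 ` (cdom c1 \<inter> cdom c)"
  \<comment> \<open>The times at which the curve also stays in the domain of \<open>c\<close>; an
    open set by continuity.\<close>
  let ?N = "{-\<epsilon><..<\<epsilon>} \<inter> (cmap c1 \<circ> \<gamma>) -` ?W"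
  have cA: "c \<in> A" "c1 \<in> A" and yc: "y \<in> cdom c1"
    using assms(2) c1 charts_atD by blast+
  have "continuous_on {-\<epsilon><..<\<epsilon>} (cmap c1 \<circ> \<gamma>)"
    using C1 Cn_on.simps(1) unfolding Ck_on_def by (metis zero_enat_def zero_le)
  then have "open ?N"
    using open_overlap[OF cA(2,1)] by (intro continuous_open_preimage) auto
  have "0 \<in> ?N"
    using \<open>\<epsilon> > 0\<close> \<open>\<gamma> 0 = y\<close> in_overlap[OF c1 assms(2)] by simp
  have 1: "(cmap c1 \<circ> \<gamma> has_derivative (\<lambda>t. t *\<^sub>R v c1)) (at 0)"
    using \<gamma>' by (simp add: has_vector_derivative_def)
  have 2: "(transition c1 c has_derivative jacobian c1 c y) (at ((cmap c1 \<circ> \<gamma>) 0))"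
    using has_derivative_transition[OF c1 assms(2)] by (simp add: \<open>\<gamma> 0 = y\<close>)
  have 3: "(?det has_derivative frechet_derivative ?det (at (cmap c y)))
      (at (transition c1 c ((cmap c1 \<circ> \<gamma>) 0)))"
    using assms(3)[unfolded frechet_derivative_works]
    by (simp add: \<open>\<gamma> 0 = y\<close> transition_cmap[OF cA(2) yc])
  have "(\<lambda>t. frechet_derivative ?det (at (cmap c y)) (jacobian c1 c y (t *\<^sub>R v c1)))
    = frechet_derivative (\<lambda>t. ?det (transition c1 c ((cmap c1 \<circ> \<gamma>) t))) (at 0)"
    by (rule frechet_derivative_at[OF has_derivative_compose[OF has_derivative_compose[OF 1 2] 3]])
  also have "\<dots> = frechet_derivative (\<lambda>_. 0) (at 0)"
  proof (rule frechet_derivative_cong_open[OF \<open>open ?N\<close> \<open>0 \<in> ?N\<close>])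
    fix t assume N: "t \<in> ?N"
    then have "\<gamma> t \<in> \<gamma> ` {-\<epsilon><..<\<epsilon>}" by blast
    with \<gamma> have t: "\<gamma> t \<in> degenerate_set A g" "\<gamma> t \<in> cdom c1" by blast+
    from N obtain p where p: "cmap c1 (\<gamma> t) = cmap c1 p" "p \<in> cdom c1" "p \<in> cdom c"
      by auto
    \<comment> \<open>Membership in \<open>?N\<close> concerns coordinates only; injectivity of the
      chart \<open>c1\<close> identifies the points.\<close>
    have "\<gamma> t = p"
      using cinv_cmap[OF cA(2) t(2)] cinv_cmap[OF cA(2) p(2)] unfolding p(1) by (rule trans[OF sym])
    then have "c \<in> charts_at A (\<gamma> t)"
      using p(3) cA by (simp add: charts_at_def)
    then show "?det (transition c1 c ((cmap c1 \<circ> \<gamma>) t)) = 0"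
      using t degenerate_set_iff_det by (simp add: transition_cmap[OF cA(2)])
  qed
  \<comment> \<open>The vanishing linear map in \<open>t\<close> is evaluated at
    \<open>t = 1\<close>.\<close>
  finally have "frechet_derivative ?det (at (cmap c y)) (jacobian c1 c y (1 *\<^sub>R v c1)) = 0"
    by (metis frechet_derivative_const)
  then show ?thesis
    using tangent_space_jacobian[OF v c1 assms(2)] by simp
qed

end

section \<open>From one chart to the manifold\<close>

theorem proposition6:
  fixes k :: enat
    and A :: "'m::{t2_space, second_countable_topology} chart set"
    and g :: "'m \<Rightarrow> 'm tvec \<Rightarrow> 'm tvec \<Rightarrow> real"
    and x :: 'm
  assumes "transverse_type_changing_spacetime k A g"
    and "k \<ge> 2"
    and "x \<in> degenerate_set A g"
    and "metric_radical A g x \<subseteq> hypersurface_tangent_space A (degenerate_set A g) x"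
  shows "energy_momentum_unbounded_at A g x"
proof -
  have g: "Ck_symmetric_tensor_field k A g"
    and trans: "\<And>y. y \<in> degenerate_set A g \<Longrightarrow> \<exists>c\<in>charts_at A y.
        frechet_derivative (\<lambda>z. det (metric_components A g c z)) (at (cmap c y)) \<noteq> (\<lambda>_. 0)"
    using assms(1) unfolding transverse_type_changing_spacetime_def by blast+
  interpret tensor_field_on_manifold A g
    using assms(1) unfolding transverse_type_changing_spacetime_def Ck_symmetric_tensor_field_def
    by unfold_locales blast+
  have loc: "local_metric (metric_components A g c) (cimage c)" if "c \<in> A" for c
  proof
    show "open (cimage c)"
      using chart[OF that] by (simp add: is_chart_def)
    show "transpose (metric_components A g c z) = metric_components A g c z" if "z \<in> cimage c" for z
      using that \<open>c \<in> A\<close> transpose_metric_components[of c] by (auto simp: charts_at_def)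
    have "enat 2 \<le> k" using assms(2) by (simp add: numeral_eq_enat)
    then show "Cn_on 2 (\<lambda>z. metric_components A g c z $ i $ j) (cimage c)" for i j
      using g that unfolding Ck_symmetric_tensor_field_def Ck_on_def by blast
  qed
  have diff: "(\<lambda>z. det (metric_components A g c z)) differentiable (at (cmap c x))"
    if c: "c \<in> charts_at A x" for c
  proof -
    interpret local_metric "metric_components A g c" "cimage c"
      by (rule loc) (use c charts_atD in blast)
    show ?thesis
      using C1_dest(3)[OF C1_delta] charts_atD[OF c] by (auto simp: delta_def[abs_def])
  qed
  obtain v where v: "v \<in> metric_radical A g x" "v \<noteq> (\<lambda>_. 0)"
    using assms(3) degenerate_set_iff_vector by blast
  then have vT: "v \<in> tangent_space A x" by (simp add: metric_radical_def)
  show ?thesis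
    unfolding energy_momentum_unbounded_at_def
  proof (intro ballI allI impI notI)
    fix c U
    assume c: "c \<in> charts_at A x" and U: "open U \<and> x \<in> U \<and> U \<subseteq> cdom c"
      and "\<exists>B. \<forall>y\<in>U - degenerate_set A g. \<forall>a b.
              \<bar>energy_momentum (metric_components A g c) a b (cmap c y)\<bar> \<le> B"
    then obtain B where B: "\<And>y a b. y \<in> U - degenerate_set A g \<Longrightarrow>
        \<bar>energy_momentum (metric_components A g c) a b (cmap c y)\<bar> \<le> B"
      by blast
    have cA: "c \<in> A" and xc: "x \<in> cdom c"
      using c charts_atD by blast+
    interpret local_metric "metric_components A g c" "cimage c"
      by (rule loc[OF cA])
    have delta: "delta = (\<lambda>z. det (metric_components A g c z))"
      by (simp add: delta_def[abs_def])
    have "\<exists>z\<in>cmap c ` U. delta z \<noteq> 0 \<and>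
        (\<exists>a b. \<bar>energy_momentum (metric_components A g c) a b z\<bar> > B)"
    proof (rule energy_momentum_unbounded)
      show "cmap c x \<in> cimage c" using xc by simp
      show "delta (cmap c x) = 0"
        using degenerate_set_iff_det[OF c] assms(3) by (simp add: delta)
      \<comment> \<open>Transversality supplies only some chart with nonzero differential; the
        contrapositive of the transfer lemma moves this to the given \<open>c\<close>.\<close>
      show "frechet_derivative delta (at (cmap c x)) \<noteq> (\<lambda>_. 0)"
        using trans[OF assms(3)] frechet_derivative_det_transfer[OF _ c assms(3) diff[OF c]]
        unfolding delta by blast
      show "metric_components A g c (cmap c x) *v v c = 0"
        using metric_radical_iff[OF vT c] v(1) by simp
      show "v c \<noteq> 0"
        using tangent_vector_eq_zero_iff[OF vT c] v(2) by simp
      \<comment> \<open>Here the radical lying in the tangent space of the degenerate set is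
        used.\<close>
      show "frechet_derivative delta (at (cmap c x)) (v c) = 0"
        using frechet_derivative_det_tangent[OF _ c diff[OF c]] assms(4) v(1)
        unfolding delta by blast
      show "open (cmap c ` U)"
        using open_chart_image[OF cA, of U] U by (simp add: Int_absorb1)
      show "cmap c x \<in> cmap c ` U" "cmap c ` U \<subseteq> cimage c"
        using U by auto
    qed
    then obtain y a b where y: "y \<in> U" "delta (cmap c y) \<noteq> 0"
      and gt: "\<bar>energy_momentum (metric_components A g c) a b (cmap c y)\<bar> > B"
      by blast
    have "c \<in> charts_at A y"
      using y(1) U cA by (auto simp: charts_at_def)
    then have "y \<in> U - degenerate_set A g"
      using y degenerate_set_iff_det by (simp add: delta)
    from B[OF this] gt show False by (meson not_less)
  qed
qed

end
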